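(* Let $\ell,m\in\mathbb{Z}_{>0}$. Let $\mathrm{ev}_m\colon\mathbb{C}[Y,Y^{-1}]\to\mathbb{C}$ be the homomorphism given by $\mathrm{ev}_m(Y)=t^{-\frac12}q^{-\frac12 m}$, and extend $\mathrm{ev}_m$ to those elements of $\mathbb{C}(Y)$ whose denominator does not evaluate to $0$. Then in $\mathbb{C}[x,x^{-1}]$ $$P_\ell(x)P_m(x)=\sum_{j=0}^{\ell}\mathrm{ev}_m\big(C_j^{(\ell)}(Y)\big)\,P_{m+\ell-2j}(x),$$ $$E_\ell(x)P_m(x)=\sum_{j=0}^{\ell-1}\mathrm{ev}_m\big(A_j^{(\ell)}(Y)\big)\,E_{m+\ell-2j}(x)+\sum_{j=0}^{\ell-1}\mathrm{ev}_m\big(B_j^{(\ell)}(Y)\big)\,E_{-m+\ell-2j}(x),$$ $$E_{-\ell}(x)P_m(x)=\sum_{j=0}^{\ell}\mathrm{ev}_m\big(t\,B_j^{(\ell+1)}(Y)\big)\,E_{m-(\ell-2j)}(x)+\sum_{j=0}^{\ell}\mathrm{ev}_m\big(A_j^{(\ell+1)}(Y)\big)\,E_{-m-(\ell-2j)}(x).$$ (In the first formula, the terms with $m+\ell-2j<0$ have coefficient $\mathrm{ev}_m(C_j^{(\ell)}(Y))=0$ and are interpreted as $0$.)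
   Context: Fix $q^{\frac12},t^{\frac12}\in\mathbb{C}^\times$, with squares $q,t$, such that the only pair of integers $(a,b)$ with $q^at^b=1$ is $(0,0)$. For $j\in\mathbb{Z}_{\ge0}$ let $(z;q)_j=(1-z)(1-zq)\cdots(1-zq^{j-1})$, with $(z;q)_0=1$. For $0\le j\le\ell$ let $$\genfrac[]{0pt}{0}{\ell}{j}_{q,t}=\frac{(q;q)_\ell/(t;q)_\ell}{\big((q;q)_j/(t;q)_j\big)\big((q;q)_{\ell-j}/(t;q)_{\ell-j}\big)}.$$ The type $SL_2$ electronic (nonsymmetric) Macdonald polynomials $E_k(x)\in\mathbb{C}[x,x^{-1}]$, $k\in\mathbb{Z}$, are $$E_{-\ell}(x)=\sum_{j=0}^{\ell}\genfrac[]{0pt}{0}{\ell}{j}_{q,t}\frac{1-tq^j}{1-tq^\ell}\,x^{\ell-2j}\quad(\ell\ge0),\qquad E_\ell(x)=\sum_{j=0}^{\ell-1}\genfrac[]{0pt}{0}{\ell-1}{j}_{q,t}\frac{q^{\ell-1-j}(1-tq^j)}{1-tq^{\ell-1}}\,x^{-\ell+2j+2}\quad(\ell\ge1),$$ and the bosonic (symmetric) Macdonald polynomials are $$P_\ell(x)=\sum_{j=0}^{\ell}\genfrac[]{0pt}{0}{\ell}{j}_{q,t}\,x^{\ell-2j}\quad(\ell\ge0).$$ Elements of $\mathbb{C}(Y)$ are defined as follows, for $\ell\in\mathbb{Z}_{>0}$, with $0\le j\le\ell$ for $C$ and $0\le j\le\ell-1$ for $A,B$: $$C_j^{(\ell)}(Y)=\genfrac[]{0pt}{0}{\ell}{j}_{q,t}\frac{(t^{-1}Y^{-2}q^{-(j-1)};q)_j\,(tY^{-2}q^{\ell-2j};q)_j}{(Y^{-2}q^{\ell-2j+1};q)_j\,(Y^{-2}q^{-j};q)_j},$$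 $$A_j^{(\ell)}(Y)=\genfrac[]{0pt}{0}{\ell}{j}_{q,t}\frac{1-q^{\ell-j}}{1-q^\ell}\cdot\frac{(t^{-1}Y^{-2}q^{-(j-1)};q)_j\,(tY^{-2}q^{\ell-2j};q)_j}{(Y^{-2}q^{-j};q)_j\,(Y^{-2}q^{\ell-2j};q)_j},$$ $$B_j^{(\ell)}(Y)=q^j\genfrac[]{0pt}{0}{\ell}{j}_{q,t}\frac{1-q^{\ell-j}}{1-q^\ell}\cdot\frac{(t^{-1}Y^{-2}q^{-(\ell-j-1)};q)_{\ell-j}\,(tY^{-2}q^{-(\ell-2j-1)};q)_{\ell-j-1}}{(Y^{-2}q^{-(\ell-2j-1)};q)_{\ell-j}\,(Y^{-2}q^{-(\ell-j-1)};q)_{\ell-j-1}}.$$ *)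

theory Defs
  imports Complex_Main "HOL-Library.Poly_Mapping" "HOL-Computational_Algebra.Fraction_Field"
    "HOL-Computational_Algebra.Polynomial"
begin

definition qpoch :: "'a::comm_ring_1 \<Rightarrow> 'a \<Rightarrow> nat \<Rightarrow> 'a" where
  "qpoch z q j = (\<Prod>i<j. 1 - z * q ^ i)"

definition qtbinom :: "complex \<Rightarrow> complex \<Rightarrow> nat \<Rightarrow> nat \<Rightarrow> complex" where
  "qtbinom q t l j =
     (qpoch q q l / qpoch t q l) /
     ((qpoch q q j / qpoch t q j) * (qpoch q q (l - j) / qpoch t q (l - j)))"


text \<open>
  The ring of Laurent polynomials in \<open>x\<close> is the group ring of the integers: finitely supported
  functions from exponents to coefficients, with convolution product.
\<close>

type_synonym laurent = "int \<Rightarrow>\<^sub>0 complex"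

abbreviation lmonom :: "complex \<Rightarrow> int \<Rightarrow> laurent" where
  "lmonom c k \<equiv> Poly_Mapping.single k c"

abbreviation lconst :: "complex \<Rightarrow> laurent" where
  "lconst c \<equiv> lmonom c 0"

definition macE :: "complex \<Rightarrow> complex \<Rightarrow> int \<Rightarrow> laurent" where
  "macE q t k =
     (if k \<le> 0 then
        let l = nat (- k) in
        (\<Sum>j\<in>{0..l}. lmonom (qtbinom q t l j * ((1 - t * q ^ j) / (1 - t * q ^ l)))
                        (int l - 2 * int j))
      else
        let l = nat k in
        (\<Sum>j\<in>{0..l - 1}. lmonom (qtbinom q t (l - 1) j *
                            (q ^ (l - 1 - j) * (1 - t * q ^ j) / (1 - t * q ^ (l - 1))))
                        (- int l + 2 * int j + 2)))"

definition macP :: "complex \<Rightarrow> complex \<Rightarrow> nat \<Rightarrow> laurent" where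
  "macP q t l = (\<Sum>j\<in>{0..l}. lmonom (qtbinom q t l j) (int l - 2 * int j))"


type_synonym ratfun = "complex poly fract"

definition rconst :: "complex \<Rightarrow> ratfun" where
  "rconst c = Fraction_Field.Fract [:c:] 1"

definition rvar :: ratfun where
  "rvar = Fraction_Field.Fract [:0, 1:] 1"

text \<open>
  A rational function is defined at \<open>y\<close> if it has some representation as a fraction whose
  denominator does not vanish at \<open>y\<close>. For \<open>y \<noteq> 0\<close> all Laurent polynomials are defined at \<open>y\<close>, and
  on them \<open>rat_eval y\<close> is the ring homomorphism to the complex numbers sending the variable
  to \<open>y\<close>. The value of \<open>rat_eval\<close> is unspecified where the function is undefined.
\<close>

definition rat_defined :: "complex \<Rightarrow> ratfun \<Rightarrow> bool" where
  "rat_defined y f \<longleftrightarrow> (\<exists>a b. poly b y \<noteq> 0 \<and> f = Fraction_Field.Fract a b)"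

definition rat_eval :: "complex \<Rightarrow> ratfun \<Rightarrow> complex" where
  "rat_eval y f =
     (THE c. \<exists>a b. poly b y \<noteq> 0 \<and> f = Fraction_Field.Fract a b \<and> c = poly a y / poly b y)"

lemma rat_eval_Fract:
  assumes "poly b y \<noteq> 0"
  shows "rat_eval y (Fraction_Field.Fract a b) = poly a y / poly b y"
  unfolding rat_eval_def
proof (rule the_equality)
  show "\<exists>a' b'. poly b' y \<noteq> 0 \<and> Fraction_Field.Fract a b = Fraction_Field.Fract a' b' \<and>
          poly a y / poly b y = poly a' y / poly b' y"
    using assms by blast
next
  fix c
  assume "\<exists>a' b'. poly b' y \<noteq> 0 \<and> Fraction_Field.Fract a b = Fraction_Field.Fract a' b' \<and>
            c = poly a' y / poly b' y"
  then obtain a' b' where *: "poly b' y \<noteq> 0"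
    "Fraction_Field.Fract a b = Fraction_Field.Fract a' b'" "c = poly a' y / poly b' y"
    by blast
  have "b \<noteq> 0" "b' \<noteq> 0" using assms * by auto
  with * have "a * b' = a' * b" by (simp add: eq_fract)
  then have "poly a y * poly b' y = poly a' y * poly b y" by (metis poly_mult)
  with assms * show "c = poly a y / poly b y" by (simp add: frac_eq_eq)
qed

lemma rat_defined_Fract: "poly b y \<noteq> 0 \<Longrightarrow> rat_defined y (Fraction_Field.Fract a b)"
  unfolding rat_defined_def by blast

lemma rat_eval_rconst: "rat_eval y (rconst c) = c"
  unfolding rconst_def by (simp add: rat_eval_Fract)

lemma rat_eval_rvar: "rat_eval y rvar = y"
  unfolding rvar_def by (simp add: rat_eval_Fract)

lemma rat_eval_add:
  assumes "rat_defined y f" "rat_defined y g"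
  shows "rat_defined y (f + g) \<and> rat_eval y (f + g) = rat_eval y f + rat_eval y g"
proof -
  obtain a b c d where *: "poly b y \<noteq> 0" "f = Fraction_Field.Fract a b"
    "poly d y \<noteq> 0" "g = Fraction_Field.Fract c d"
    using assms unfolding rat_defined_def by blast
  have "b \<noteq> 0" "d \<noteq> 0" using * by auto
  then have "f + g = Fraction_Field.Fract (a * d + c * b) (b * d)" using * by simp
  then show ?thesis using *
    by (simp add: rat_eval_Fract rat_defined_Fract add_frac_eq)
qed

lemma rat_eval_mult:
  assumes "rat_defined y f" "rat_defined y g"
  shows "rat_defined y (f * g) \<and> rat_eval y (f * g) = rat_eval y f * rat_eval y g"
proof -
  obtain a b c d where *: "poly b y \<noteq> 0" "f = Fraction_Field.Fract a b"
    "poly d y \<noteq> 0" "g = Fraction_Field.Fract c d"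
    using assms unfolding rat_defined_def by blast
  then have "f * g = Fraction_Field.Fract (a * c) (b * d)" by simp
  then show ?thesis using *
    by (simp add: rat_eval_Fract rat_defined_Fract)
qed


text \<open>
  The factor \<open>(c Y^(-2); q)_n\<close>, with \<open>c\<close> a complex scalar, as a rational function in \<open>Y\<close>.
\<close>

definition Ypoch :: "complex \<Rightarrow> complex \<Rightarrow> nat \<Rightarrow> ratfun" where
  "Ypoch q c n = qpoch (rconst c * rvar powi (- 2)) (rconst q) n"

definition coeffC :: "complex \<Rightarrow> complex \<Rightarrow> nat \<Rightarrow> nat \<Rightarrow> ratfun" where
  "coeffC q t l j =
     rconst (qtbinom q t l j) *
     ((Ypoch q (inverse t * q powi (- (int j - 1))) j * Ypoch q (t * q powi (int l - 2 * int j)) j) /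
      (Ypoch q (q powi (int l - 2 * int j + 1)) j * Ypoch q (q powi (- int j)) j))"

definition coeffA :: "complex \<Rightarrow> complex \<Rightarrow> nat \<Rightarrow> nat \<Rightarrow> ratfun" where
  "coeffA q t l j =
     rconst (qtbinom q t l j * ((1 - q ^ (l - j)) / (1 - q ^ l))) *
     ((Ypoch q (inverse t * q powi (- (int j - 1))) j * Ypoch q (t * q powi (int l - 2 * int j)) j) /
      (Ypoch q (q powi (- int j)) j * Ypoch q (q powi (int l - 2 * int j)) j))"

definition coeffB :: "complex \<Rightarrow> complex \<Rightarrow> nat \<Rightarrow> nat \<Rightarrow> ratfun" where
  "coeffB q t l j =
     rconst (q ^ j * qtbinom q t l j * ((1 - q ^ (l - j)) / (1 - q ^ l))) *
     ((Ypoch q (inverse t * q powi (- (int l - int j - 1))) (l - j) *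
       Ypoch q (t * q powi (- (int l - 2 * int j - 1))) (l - j - 1)) /
      (Ypoch q (q powi (- (int l - 2 * int j - 1))) (l - j) *
       Ypoch q (q powi (- (int l - int j - 1))) (l - j - 1)))"

end

theory Submission
  imports Defs
begin

text \<open>
  Put \<open>Q = q^n\<close> and let \<open>D_n\<close> be the sum defining \<open>P_n\<close> with its \<open>j\<close>-th coefficient multiplied by
  \<open>q^j\<close>. The four Laurent polynomials \<open>E_n\<close>, \<open>E_(-n)\<close>, \<open>x^(-1) E_(n+1)\<close> and \<open>x^(-1) E_(1-n)\<close> all
  lie in the span of \<open>P_n\<close> and \<open>D_n\<close>, with simple coefficients (\<open>macE_in_basis\<close>). So
  multiplication by \<open>x\<close> maps the span of \<open>E_n, E_(-n)\<close> onto that of \<open>E_(n+1), E_(1-n)\<close>, and plane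
  linear algebra yields the two-term recurrences
  \<open>x E_n = E_(n+1) - Q \<mu> E_(1-n)\<close> and \<open>x^(-1) E_(1-n) = E_(-n) - \<mu> E_n\<close> for \<open>n > 0\<close>, where
  \<open>\<mu> = (1-t)/(1-tQ)\<close>, similar formulas for \<open>x E_(-n)\<close> and \<open>x^(-1) E_(n+1)\<close>, and
  \<open>P_n = E_(-n) + t (1-Q)/(1-tQ) E_n\<close>.

  Starting with \<open>E_0\<close> and \<open>E_1\<close>, these two recurrences generate all \<open>E_k\<close>, in the order
  \<open>E_(-1), E_2, E_(-2), E_3, \<dots>\<close>. Multiply them by \<open>P_m\<close> and suppose that \<open>E_n P_m\<close> and
  \<open>E_(1-n) P_m\<close> are known. With \<open>N = m + n - 2j\<close> and the part of each expansion that contains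
  \<open>B\<close> read backwards, the claims for these products are
  \<open>E_n P_m = \<Sum>j. A_j^(n) E_N + B_(n-j)^(n) E_(-N)\<close> and
  \<open>E_(1-n) P_m = \<Sum>j. t B_(n-j)^(n) E_(N+1) + A_j^(n) E_(1-N)\<close>, while those for the next two are
  \<open>E_(n+1) P_m = \<Sum>j. A_j^(n+1) E_(N+1) + B_(n-j)^(n+1) E_(1-N)\<close> and
  \<open>E_(-n) P_m = \<Sum>j. t B_(n-j)^(n+1) E_N + A_j^(n+1) E_(-N)\<close>. For each \<open>j\<close> separately the
  recurrences for \<open>E\<close> turn the \<open>j\<close>-th terms of the first pair into those of the second
  (\<open>x_step\<close>, \<open>inverse_x_step\<close>), so that an induction on \<open>n\<close> proves the expansions. The formula for
  \<open>P_n P_m\<close> follows from \<open>P_n = E_(-n) + t (1-Q)/(1-tQ) E_n\<close>, again term by term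
  (\<open>symmetrized_term\<close>).

  What has to be known about the coefficients are thus linear relations between \<open>C_j^(n)\<close>,
  \<open>A_j^(n)\<close>, \<open>B_(n-j)^(n)\<close>, \<open>A_j^(n+1)\<close> and \<open>B_(n-j)^(n+1)\<close>, evaluated at \<open>Y^(-2) = t q^m\<close>. The last
  four are multiples of \<open>C_j^(n)\<close> by short rational functions of \<open>u = q^(n-j)\<close>, \<open>v = q^(m-j)\<close>,
  \<open>J = q^j\<close> and \<open>t\<close> (\<open>evA_ratio\<close> and the lemmas after it), which makes the relations identities
  between rational functions (\<open>coefficient_recurrences\<close>).

  The recurrences for \<open>E_k\<close> depend on the sign of \<open>k\<close>. They can be applied uniformly because
  \<open>C_j^(n)\<close> contains the factor \<open>(q^(m-j+1); q)_j\<close>, which vanishes for \<open>j > m\<close>: the coefficients of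
  all terms with negative \<open>N\<close> are zero.
\<close>

section \<open>Laurent polynomials and shifted factorials\<close>

lemma lookup_monom_mult:
  fixes f :: laurent
  shows "Poly_Mapping.lookup (lmonom c a * f) k = c * Poly_Mapping.lookup f (k - a)"
proof (induction f rule: update_induct)
  case const
  show ?case by simp
next
  case (update f b v)
  have "Poly_Mapping.update b v f = f + Poly_Mapping.single b v"
    using update by (intro poly_mapping_eqI)
      (auto simp: lookup_add lookup_single lookup_update in_keys_iff when_def)
  then show ?case
    using update by (simp add: algebra_simps lookup_add mult_single lookup_single when_def)
qed

lemma lmonom_cong: "a = b \<Longrightarrow> k = k' \<Longrightarrow> lmonom a k = lmonom b k'"
  by simp

lemma qpoch_0 [simp]: "qpoch z q 0 = 1"
  by (simp add: qpoch_def)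

lemma qpoch_Suc: "qpoch z q (Suc n) = qpoch z q n * (1 - z * q ^ n)"
  by (simp add: qpoch_def)

lemma qpoch_Suc_left: "qpoch z q (Suc n) = (1 - z) * qpoch (z * q) q n"
  unfolding qpoch_def by (subst prod.lessThan_Suc_shift) (simp add: mult_ac)

lemma qpoch_shift: "(1 - z) * qpoch (z * q) q n = (1 - z * q ^ n) * qpoch z q n"
  by (metis qpoch_Suc qpoch_Suc_left mult.commute)

section \<open>The two-parameter binomial coefficients\<close>

locale generic_parameters =
  fixes q t :: complex
  assumes q_nonzero: "q \<noteq> 0" and t_nonzero: "t \<noteq> 0"
    and generic: "\<And>a b :: int. q powi a * t powi b = 1 \<Longrightarrow> a = 0 \<and> b = 0"
begin

lemma q_power_neq_1: "n > 0 \<Longrightarrow> 1 - q ^ n \<noteq> 0"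
  using generic[of "int n" 0] by auto

lemma t_q_powi_neq_1: "1 - t * q powi k \<noteq> 0"
  using generic[of k 1] by (auto simp: mult.commute)

lemma t_q_power_neq_1: "1 - t * q ^ n \<noteq> 0"
  using t_q_powi_neq_1[of "int n"] by simp

lemma t2_q_powi_neq_1: "1 - t\<^sup>2 * q powi k \<noteq> 0"
  using generic[of k 2] by (auto simp: mult.commute)

lemma qpoch_q_nonzero: "qpoch q q n \<noteq> 0"
  using q_power_neq_1[of "Suc _"] by (simp add: qpoch_def)

lemma qpoch_t_nonzero: "qpoch t q n \<noteq> 0"
  using t_q_power_neq_1 by (simp add: qpoch_def)

lemma qtbinom_0 [simp]: "qtbinom q t n 0 = 1"
  using qpoch_q_nonzero qpoch_t_nonzero by (simp add: qtbinom_def)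

lemma qtbinom_symmetric: "j \<le> n \<Longrightarrow> qtbinom q t n (n - j) = qtbinom q t n j"
  by (simp add: qtbinom_def mult.commute)

lemma qtbinom_Suc_Suc:
  assumes "j \<le> n"
  shows "qtbinom q t (Suc n) (Suc j) * ((1 - t * q ^ n) * (1 - q ^ Suc j)) =
         qtbinom q t n j * ((1 - q ^ Suc n) * (1 - t * q ^ j))"
  using qpoch_q_nonzero qpoch_t_nonzero t_q_power_neq_1 q_power_neq_1[of "Suc _"]
  by (simp add: qtbinom_def qpoch_Suc frac_eq_eq)

lemma qtbinom_Suc:
  assumes "j \<le> n"
  shows "qtbinom q t (Suc n) j * ((1 - t * q ^ n) * (1 - q ^ Suc (n - j))) =
         qtbinom q t n j * ((1 - q ^ Suc n) * (1 - t * q ^ (n - j)))"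
  using qtbinom_Suc_Suc[of "n - j" n] qtbinom_symmetric[of j n]
    qtbinom_symmetric[of j "Suc n"] assms
  by (simp add: Suc_diff_le)

section \<open>Two-term recurrences for the electronic polynomials\<close>

text \<open>
  The companion of \<open>P_n\<close> that completes it to a basis of the plane containing \<open>E_n\<close> and \<open>E_(-n)\<close>.
\<close>

definition macD :: "nat \<Rightarrow> laurent" where
  "macD n = (\<Sum>j\<in>{0..n}. lmonom (qtbinom q t n j * q ^ j) (int n - 2 * int j))"

lemma macE_neg_eq:
  "lconst (1 - t * q ^ n) * macE q t (- int n) = macP q t n - lconst t * macD n"
  using t_q_power_neq_1[of n]
  by (simp add: macE_def macP_def macD_def sum_distrib_left mult_single
      flip: sum_subtractf single_diff) (simp add: algebra_simps)

text \<open>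
  Reversing the summation order turns the weight \<open>q^(n-j) (1 - t q^j)\<close> of \<open>E_(n+1)\<close> into
  \<open>q^j - t q^n\<close>.
\<close>
lemma macE_pos_Suc_eq:
  "lconst (1 - t * q ^ n) * macE q t (int n + 1) =
     lmonom 1 1 * (macD n - lconst (t * q ^ n) * macP q t n)"
proof -
  have *: "qtbinom q t n j * (q ^ (n - j) * (1 - t * q ^ j)) =
    qtbinom q t n (n - j) * q ^ (n - j) - t * q ^ n * qtbinom q t n (n - j)" if "j \<le> n" for j
    using that by (simp add: qtbinom_symmetric algebra_simps flip: power_add)
  have "lconst (1 - t * q ^ n) * macE q t (int n + 1) =
    (\<Sum>j\<in>{0..n}. lmonom (qtbinom q t n j * (q ^ (n - j) * (1 - t * q ^ j)))
                       (1 + (int n - 2 * int (n - j))))"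
    using t_q_power_neq_1[of n]
    by (auto simp: macE_def nat_add_distrib sum_distrib_left mult_single of_nat_diff
        intro!: sum.cong lmonom_cong)
  also have "\<dots> = (\<Sum>j\<in>{0..n}.
      lmonom (qtbinom q t n (n - j) * q ^ (n - j) - t * q ^ n * qtbinom q t n (n - j))
        (1 + (int n - 2 * int (n - j))))"
    using * by (intro sum.cong) auto
  also have "\<dots> = (\<Sum>j\<in>{0..n}.
      lmonom (qtbinom q t n j * q ^ j - t * q ^ n * qtbinom q t n j) (1 + (int n - 2 * int j)))"
    by (subst sum.atLeastAtMost_rev) (rule sum.cong, auto)
  also have "\<dots> = lmonom 1 1 * (macD n - lconst (t * q ^ n) * macP q t n)"
    by (simp add: macD_def macP_def sum_distrib_left mult_single single_diff
      right_diff_distrib sum_subtractf)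
  finally show ?thesis .
qed

text \<open>
  The factor \<open>1 - q^j\<close> kills the term \<open>j = 0\<close>, and in the others it lowers both indices of the
  two-parameter binomial coefficient by one, leaving the weight \<open>1 - t q^(j-1)\<close> of \<open>E_(-n)\<close>.
\<close>
lemma macP_minus_macD:
  "macP q t (Suc n) - macD (Suc n) =
     lconst (1 - q ^ Suc n) * (lmonom 1 (- 1) * macE q t (- int n))"
proof -
  have "macP q t (Suc n) - macD (Suc n) =
    (\<Sum>j\<in>{0..Suc n}. lmonom (qtbinom q t (Suc n) j * (1 - q ^ j)) (int (Suc n) - 2 * int j))"
    by (simp add: macP_def macD_def algebra_simps single_diff flip: sum_subtractf)
  also have "\<dots> = (\<Sum>j\<in>{0..n}.
      lmonom (qtbinom q t (Suc n) (Suc j) * (1 - q ^ Suc j)) (int n - 1 - 2 * int j))"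
    by (subst sum.atLeast0_atMost_Suc_shift) (auto intro!: sum.cong lmonom_cong)
  also have "\<dots> = (\<Sum>j\<in>{0..n}.
      lmonom ((1 - q ^ Suc n) * (qtbinom q t n j * ((1 - t * q ^ j) / (1 - t * q ^ n))))
        (int n - 1 - 2 * int j))"
    using qtbinom_Suc_Suc t_q_power_neq_1[of n]
    by (intro sum.cong refl lmonom_cong) (auto simp: field_simps)
  also have "\<dots> = lconst (1 - q ^ Suc n) * (lmonom 1 (- 1) * macE q t (- int n))"
    by (auto simp: macE_def sum_distrib_left mult_single intro!: sum.cong lmonom_cong)
  finally show ?thesis .
qed

text \<open>
  As before, but now \<open>q^j - q^(n+1)\<close> kills the last term, and it is the complementary index that
  is lowered.
\<close>
lemma macD_minus_macP:
  "macD (Suc n) - lconst (q ^ Suc n) * macP q t (Suc n) =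
     lconst (1 - q ^ Suc n) * macE q t (int n + 1)"
proof -
  have "macD (Suc n) - lconst (q ^ Suc n) * macP q t (Suc n) =
    (\<Sum>j\<in>{0..Suc n}. lmonom (qtbinom q t (Suc n) j * (q ^ j - q ^ Suc n)) (int (Suc n) - 2 * int j))"
    by (simp add: macP_def macD_def algebra_simps mult_single single_diff sum_distrib_left
        flip: sum_subtractf)
  also have "\<dots> = (\<Sum>j\<in>{0..n}.
      lmonom (qtbinom q t (Suc n) j * (q ^ j - q ^ Suc n)) (int n + 1 - 2 * int j))"
    by (subst sum.atLeast0_atMost_Suc) (simp add: algebra_simps)
  also have "\<dots> = (\<Sum>j\<in>{0..n}.
      lmonom (qtbinom q t (Suc n) (n - j) * (q ^ (n - j) - q ^ Suc n))
        (int n + 1 - 2 * int (n - j)))"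
    by (subst sum.atLeastAtMost_rev) simp
  also have "\<dots> = (\<Sum>j\<in>{0..n}.
      lmonom ((1 - q ^ Suc n) *
          (qtbinom q t n j * (q ^ (n - j) * (1 - t * q ^ j) / (1 - t * q ^ n))))
        (- int n + 1 + 2 * int j))"
  proof (intro sum.cong refl)
    fix j assume "j \<in> {0..n}"
    then have j: "j \<le> n" by simp
    have 1: "q ^ (n - j) - q ^ Suc n = q ^ (n - j) * (1 - q ^ Suc j)"
      using j by (simp add: algebra_simps flip: power_add)
    have 2: "qtbinom q t (Suc n) (n - j) * ((1 - t * q ^ n) * (1 - q ^ Suc j)) =
         qtbinom q t n j * ((1 - q ^ Suc n) * (1 - t * q ^ j))"
      using qtbinom_Suc[of "n - j" n] qtbinom_symmetric[OF j] j by simp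
    have "(1 - t * q ^ n) * (qtbinom q t (Suc n) (n - j) * (q ^ (n - j) - q ^ Suc n)) =
        q ^ (n - j) * (qtbinom q t (Suc n) (n - j) * ((1 - t * q ^ n) * (1 - q ^ Suc j)))"
      unfolding 1 by (simp only: mult_ac)
    also have "\<dots> = (1 - q ^ Suc n) * (qtbinom q t n j * (q ^ (n - j) * (1 - t * q ^ j)))"
      unfolding 2 by (simp only: mult_ac)
    finally have "(1 - t * q ^ n) * (qtbinom q t (Suc n) (n - j) * (q ^ (n - j) - q ^ Suc n)) =
        (1 - q ^ Suc n) * (qtbinom q t n j * (q ^ (n - j) * (1 - t * q ^ j)))" .
    then have "qtbinom q t (Suc n) (n - j) * (q ^ (n - j) - q ^ Suc n) =
        (1 - q ^ Suc n) * (qtbinom q t n j * (q ^ (n - j) * (1 - t * q ^ j))) / (1 - t * q ^ n)"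
      using t_q_power_neq_1[of n] by (metis nonzero_mult_div_cancel_left)
    then show "lmonom (qtbinom q t (Suc n) (n - j) * (q ^ (n - j) - q ^ Suc n))
          (int n + 1 - 2 * int (n - j)) =
        lmonom ((1 - q ^ Suc n) *
            (qtbinom q t n j * (q ^ (n - j) * (1 - t * q ^ j) / (1 - t * q ^ n))))
          (- int n + 1 + 2 * int j)"
      using j by (intro lmonom_cong) (simp_all add: of_nat_diff)
  qed
  also have "\<dots> = lconst (1 - q ^ Suc n) * macE q t (int n + 1)"
    by (auto simp: macE_def nat_add_distrib sum_distrib_left mult_single
        intro!: sum.cong lmonom_cong)
  finally show ?thesis .
qed

lemma laurent_solve:
  fixes f g :: laurent
  assumes "lconst c * f = g" "c \<noteq> 0"
  shows "f = lconst (1 / c) * g"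
  using assms by (simp add: mult_single flip: assms(1) mult.assoc)

text \<open>
  These are linear relations among vectors in the plane spanned by \<open>P_n\<close> and \<open>D_n\<close>; every
  recurrence below is read off by comparing coordinates.
\<close>
lemma macE_in_basis:
  assumes "n > 0"
  shows "macE q t (- int n) = lconst (1 / (1 - t * q ^ n)) * (macP q t n - lconst t * macD n)"
    and "macE q t (int n) = lconst (1 / (1 - q ^ n)) * (macD n - lconst (q ^ n) * macP q t n)"
    and "lmonom 1 (- 1) * macE q t (1 - int n) = lconst (1 / (1 - q ^ n)) * (macP q t n - macD n)"
    and "lmonom 1 (- 1) * macE q t (int n + 1) =
           lconst (1 / (1 - t * q ^ n)) * (macD n - lconst (t * q ^ n) * macP q t n)"
proof -
  obtain k where n: "n = Suc k"
    using assms by (cases n) auto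
  show "macE q t (- int n) = lconst (1 / (1 - t * q ^ n)) * (macP q t n - lconst t * macD n)"
    by (intro laurent_solve macE_neg_eq t_q_power_neq_1)
  show "macE q t (int n) = lconst (1 / (1 - q ^ n)) * (macD n - lconst (q ^ n) * macP q t n)"
    using macD_minus_macP[of k] assms
    by (intro laurent_solve q_power_neq_1) (simp_all add: n add.commute)
  show "lmonom 1 (- 1) * macE q t (1 - int n) = lconst (1 / (1 - q ^ n)) * (macP q t n - macD n)"
    using macP_minus_macD[of k] assms
    by (intro laurent_solve q_power_neq_1) (simp_all add: n)
  show "lmonom 1 (- 1) * macE q t (int n + 1) =
           lconst (1 / (1 - t * q ^ n)) * (macD n - lconst (t * q ^ n) * macP q t n)"
  proof (rule laurent_solve[OF _ t_q_power_neq_1])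
    have "lconst (1 - t * q ^ n) * (lmonom 1 (- 1) * macE q t (int n + 1)) =
      lmonom 1 (- 1) * (lmonom 1 1 * (macD n - lconst (t * q ^ n) * macP q t n))"
      by (simp add: mult.left_commute flip: macE_pos_Suc_eq)
    then show "lconst (1 - t * q ^ n) * (lmonom 1 (- 1) * macE q t (int n + 1)) =
      macD n - lconst (t * q ^ n) * macP q t n"
      by (simp add: mult_single flip: mult.assoc single_one)
  qed
qed

lemma macE_0 [simp]: "macE q t 0 = 1" and macE_1: "macE q t 1 = lmonom 1 1"
  using t_q_power_neq_1[of 0] by (simp_all add: macE_def)

lemma macP_0 [simp]: "macP q t 0 = 1"
  by (simp add: macP_def)

text \<open>
  The coefficients of the recurrences, as functions of \<open>z = q^n\<close>. When \<open>E_(\<plusminus>n)\<close>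
  is multiplied by \<open>x\<close> or \<open>x^(-1)\<close>, the neighbour whose index has the opposite sign appears with
  the mixing coefficient, up to sign and a factor \<open>z\<close>, and a neighbour closer to index zero
  with the damping coefficient. The symmetrizer is the multiple of \<open>E_n\<close> that makes
  \<open>E_(-n)\<close> symmetric under \<open>x \<mapsto> x^(-1)\<close>.
\<close>
definition mixing :: "complex \<Rightarrow> complex" where
  "mixing z = (1 - t) / (1 - t * z)"

definition damping :: "complex \<Rightarrow> complex" where
  "damping z = (1 - z) * (1 - t\<^sup>2 * z) / (1 - t * z)\<^sup>2"

definition symmetrizer :: "complex \<Rightarrow> complex" where
  "symmetrizer z = t * (1 - z) / (1 - t * z)"

lemmas step_defs = mixing_def damping_def symmetrizer_def

lemma inverse_x_macE_neg:
  assumes "n > 0"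
  shows "lmonom 1 (- 1) * macE q t (1 - int n) =
    macE q t (- int n) - lconst (mixing (q ^ n)) * macE q t (int n)"
  unfolding macE_in_basis[OF assms] step_defs
  by (rule poly_mapping_eqI, use t_q_power_neq_1[of n] q_power_neq_1[OF assms] in
     \<open>simp add: lookup_monom_mult lookup_add lookup_minus divide_simps\<close>) (simp add: algebra_simps)

lemma inverse_x_macE_pos:
  "lmonom 1 (- 1) * macE q t (int n + 1) =
    lconst (damping (q ^ n)) * macE q t (int n) +
    lconst (q ^ n * mixing (q ^ n)) * macE q t (- int n)"
proof (cases "n = 0")
  case True
  then show ?thesis using t_q_power_neq_1[of 0] by (simp add: step_defs macE_1 mult_single)
next
  case False
  then have n: "n > 0" by simp
  show ?thesis
    unfolding macE_in_basis[OF n] step_defs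
    by (rule poly_mapping_eqI, use t_q_power_neq_1[of n] q_power_neq_1[OF n] in
     \<open>simp add: lookup_monom_mult lookup_add lookup_minus divide_simps\<close>) algebra
qed

lemma x_mult_cancel:
  fixes f g :: laurent
  assumes "f = lmonom 1 (- 1) * g"
  shows "lmonom 1 1 * f = g"
  by (simp add: assms mult_single flip: mult.assoc)

lemma x_macE_pos:
  assumes "n > 0"
  shows "lmonom 1 1 * macE q t (int n) =
    macE q t (int n + 1) - lconst (q ^ n * mixing (q ^ n)) * macE q t (1 - int n)"
proof (rule x_mult_cancel)
  show "macE q t (int n) =
    lmonom 1 (- 1) *
      (macE q t (int n + 1) - lconst (q ^ n * mixing (q ^ n)) * macE q t (1 - int n))"
    unfolding right_diff_distrib mult.left_commute[of "lmonom 1 (-1)" "lconst _"]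
      macE_in_basis[OF assms] step_defs
    by (rule poly_mapping_eqI, use t_q_power_neq_1[of n] q_power_neq_1[OF assms] in
     \<open>simp add: lookup_monom_mult lookup_add lookup_minus divide_simps\<close>) algebra
qed

lemma x_macE_neg:
  "lmonom 1 1 * macE q t (- int n) =
    lconst (damping (q ^ n)) * macE q t (1 - int n) +
    lconst (mixing (q ^ n)) * macE q t (int n + 1)"
proof (cases "n = 0")
  case True
  then show ?thesis using t_q_power_neq_1[of 0] by (simp add: step_defs macE_1)
next
  case False
  then have n: "n > 0" by simp
  show ?thesis
  proof (rule x_mult_cancel)
    show "macE q t (- int n) = lmonom 1 (- 1) *
      (lconst (damping (q ^ n)) * macE q t (1 - int n) +
       lconst (mixing (q ^ n)) * macE q t (int n + 1))"
      unfolding distrib_left mult.left_commute[of "lmonom 1 (-1)" "lconst _"]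
      macE_in_basis[OF n] step_defs
      by (rule poly_mapping_eqI, use t_q_power_neq_1[of n] q_power_neq_1[OF n] in
        \<open>simp add: lookup_monom_mult lookup_add lookup_minus divide_simps\<close>) algebra
  qed
qed

lemma macP_eq_macE:
  "macP q t n = macE q t (- int n) + lconst (symmetrizer (q ^ n)) * macE q t (int n)"
proof (cases "n = 0")
  case True
  then show ?thesis by (simp add: step_defs)
next
  case False
  then have n: "n > 0" by simp
  show ?thesis
    unfolding macE_in_basis[OF n] step_defs
    by (rule poly_mapping_eqI, use t_q_power_neq_1[of n] q_power_neq_1[OF n] in
     \<open>simp add: lookup_monom_mult lookup_add lookup_minus divide_simps\<close>) (simp add: algebra_simps)
qed

end
section \<open>Evaluation of rational functions\<close>

text \<open>
  Definedness and value in a single predicate, so that both propagate through one set of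
  introduction rules that follow the structure of the term.
\<close>

definition rat_value :: "complex \<Rightarrow> ratfun \<Rightarrow> complex \<Rightarrow> bool" where
  "rat_value y f c \<longleftrightarrow> rat_defined y f \<and> rat_eval y f = c"

lemma rat_valueD: "rat_value y f c \<Longrightarrow> rat_eval y f = c" "rat_value y f c \<Longrightarrow> rat_defined y f"
  by (simp_all add: rat_value_def)

lemma rat_value_Fract:
  "poly b y \<noteq> 0 \<Longrightarrow> rat_value y (Fraction_Field.Fract a b) (poly a y / poly b y)"
  by (simp add: rat_value_def rat_eval_Fract rat_defined_Fract)

lemma rat_value_rconst: "rat_value y (rconst c) c"
  using rat_value_Fract[of 1 y "[:c:]"] by (simp add: rconst_def)

lemma rat_value_rvar: "rat_value y rvar y"
  using rat_value_Fract[of 1 y "[:0, 1:]"] by (simp add: rvar_def)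

lemma rat_value_1: "rat_value y 1 1"
  using rat_value_Fract[of 1 y 1] unfolding One_fract_def by (simp del: One_fract_def)

lemma rat_value_mult: "rat_value y f a \<Longrightarrow> rat_value y g b \<Longrightarrow> rat_value y (f * g) (a * b)"
  using rat_eval_mult by (auto simp: rat_value_def)

lemma rat_value_diff:
  assumes "rat_value y f a" "rat_value y g b"
  shows "rat_value y (f - g) (a - b)"
proof -
  have "rconst (- 1) = - 1"
    unfolding rconst_def One_fract_def minus_fract by (simp only: one_pCons minus_pCons minus_zero)
  then have *: "f - g = f + rconst (- 1) * g"
    by simp
  moreover have "rat_value y (rconst (- 1) * g) (- 1 * b)"
    by (intro rat_value_mult rat_value_rconst assms)
  ultimately show ?thesis
    using rat_eval_add[of y f "rconst (- 1) * g"] assms(1)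
    unfolding * by (simp add: rat_value_def)
qed

lemma rat_value_inverse:
  assumes "rat_value y f a" "a \<noteq> 0"
  shows "rat_value y (inverse f) (inverse a)"
proof -
  obtain c d where f: "poly d y \<noteq> 0" "f = Fraction_Field.Fract c d"
    using assms by (auto simp: rat_value_def rat_defined_def)
  with assms have "a = poly c y / poly d y"
    by (simp add: rat_value_def rat_eval_Fract)
  with f assms show ?thesis
    using rat_value_Fract[of c y d] by simp
qed

lemma rat_value_divide:
  "rat_value y f a \<Longrightarrow> rat_value y g b \<Longrightarrow> b \<noteq> 0 \<Longrightarrow> rat_value y (f / g) (a / b)"
  by (simp add: divide_inverse rat_value_mult rat_value_inverse)

lemma rat_value_power: "rat_value y f a \<Longrightarrow> rat_value y (f ^ n) (a ^ n)"
  by (induction n) (simp_all add: rat_value_1 rat_value_mult)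

lemma rat_value_qpoch:
  "rat_value y f a \<Longrightarrow> rat_value y g b \<Longrightarrow> rat_value y (qpoch f g n) (qpoch a b n)"
  by (induction n)
    (auto simp: qpoch_Suc intro!: rat_value_1 rat_value_mult rat_value_diff rat_value_power)

lemma rat_value_Ypoch:
  assumes "y \<noteq> 0"
  shows "rat_value y (Ypoch q c n) (qpoch (c * y powi (- 2)) q n)"
  unfolding Ypoch_def using assms
  unfolding power_int_minus power_int_numeral
  by (intro rat_value_qpoch rat_value_mult rat_value_rconst rat_value_inverse rat_value_power
      rat_value_rvar) simp_all

section \<open>Ratios of the evaluated coefficients\<close>

text \<open>
  Only \<open>Y^(-2)\<close> occurs in the coefficients, so the evaluation point matters only through
  \<open>y powi (-2)\<close>.
\<close>

locale evaluation_point = generic_parameters +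
  fixes m :: nat and y :: complex
  assumes y_powi: "y powi (- 2) = t * q ^ m"
begin

lemma rat_value_Ypoch_point:
  assumes "c * (t * q ^ m) = d"
  shows "rat_value y (Ypoch q c n) (qpoch d q n)"
proof -
  have "y \<noteq> 0"
    using y_powi t_nonzero q_nonzero by auto
  from rat_value_Ypoch[OF this] show ?thesis
    by (simp add: y_powi flip: assms)
qed

text \<open>
  The denominators of the coefficients never vanish at \<open>y\<close>: their factors are \<open>1 - t q^k\<close>.
\<close>
lemma qpoch_point_nonzero:
  assumes "q powi k * (t * q ^ m) = d"
  shows "qpoch d q n \<noteq> 0"
proof -
  have "d * q ^ i = t * q powi (k + int m + int i)" for i
    using q_nonzero by (simp add: power_int_add flip: assms)
  then show ?thesis
    using t_q_powi_neq_1 by (auto simp: qpoch_def)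
qed

lemma q_powi_mult_cong: "a + b = c + d \<Longrightarrow> q powi a * q powi b = q powi c * q powi d"
  using q_nonzero by (simp flip: power_int_add)

context
  fixes n j :: nat and u v :: complex
  assumes j_le: "j \<le> n"
    and u: "u = q ^ (n - j)" and v: "v = q powi (int m - int j)"
begin

text \<open>
  The arguments of the shifted factorials in \<open>C_j\<close> and \<open>A_j\<close>, after \<open>Y^(-2)\<close> has become \<open>t q^m\<close>.
  The exponents of \<open>q\<close> add up to those of \<open>u = q^(n-j)\<close> and \<open>v = q^(m-j)\<close>.
\<close>
lemma q_powi_shift:
  "inverse t * q powi (- (int j - 1)) * (t * q ^ m) = v * q"
  "t * q powi (int n - 2 * int j) * (t * q ^ m) = t\<^sup>2 * u * v"
  "q powi (int n - 2 * int j) * (t * q ^ m) = t * u * v"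
  "q powi (int n - 2 * int j + 1) * (t * q ^ m) = t * u * v * q"
  "q powi (- int j) * (t * q ^ m) = t * v"
proof -
  have u': "u = q powi (int n - int j)"
    using j_le by (simp add: u flip: of_nat_diff)
  have "inverse t * q powi (- (int j - 1)) * (t * q ^ m) = q powi (- (int j - 1)) * q powi int m"
    using t_nonzero by simp
  also have "\<dots> = v * q powi 1"
    unfolding v by (rule q_powi_mult_cong) simp
  finally show "inverse t * q powi (- (int j - 1)) * (t * q ^ m) = v * q"
    by simp
  have 1: "q powi (int n - 2 * int j) * q ^ m = u * v"
    using q_powi_mult_cong[of "int n - 2 * int j" "int m" "int n - int j" "int m - int j"]
    by (simp add: u' v)
  have 2: "q powi (int n - 2 * int j + 1) * q ^ m = u * v * q"
    using q_powi_mult_cong[of "int n - 2 * int j + 1" 0 "int n - 2 * int j" 1]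
      arg_cong[OF 1, of "(*) q"]
    by (simp add: mult_ac)
  have 3: "q powi (- int j) * q ^ m = v"
    using q_powi_mult_cong[of "- int j" "int m" "int m - int j" 0]
    by (simp add: v)
  show "t * q powi (int n - 2 * int j) * (t * q ^ m) = t\<^sup>2 * u * v"
    "q powi (int n - 2 * int j) * (t * q ^ m) = t * u * v"
    "q powi (int n - 2 * int j + 1) * (t * q ^ m) = t * u * v * q"
    "q powi (- int j) * (t * q ^ m) = t * v"
    using arg_cong[OF 1, of "(*) (t\<^sup>2)"] arg_cong[OF 1, of "(*) t"]
      arg_cong[OF 2, of "(*) t"] arg_cong[OF 3, of "(*) t"]
    by (simp_all only: power2_eq_square mult_ac)
qed

lemma rat_value_coeffC:
  "rat_value y (coeffC q t n j)
     (qtbinom q t n j *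
       ((qpoch (v * q) q j * qpoch (t\<^sup>2 * u * v) q j) /
        (qpoch (t * u * v * q) q j * qpoch (t * v) q j)))"
  unfolding coeffC_def
  by (intro rat_value_mult rat_value_rconst rat_value_divide no_zero_divisors
      q_powi_shift[THEN rat_value_Ypoch_point] q_powi_shift(4,5)[THEN qpoch_point_nonzero])

lemma rat_value_coeffA:
  "rat_value y (coeffA q t n j)
     (qtbinom q t n j * ((1 - u) / (1 - q ^ n)) *
       ((qpoch (v * q) q j * qpoch (t\<^sup>2 * u * v) q j) /
        (qpoch (t * v) q j * qpoch (t * u * v) q j)))"
  unfolding coeffA_def u[symmetric]
  by (intro rat_value_mult rat_value_rconst rat_value_divide no_zero_divisors
      q_powi_shift[THEN rat_value_Ypoch_point] q_powi_shift(3,5)[THEN qpoch_point_nonzero])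

end

lemma q_powi_shift_B:
  assumes "j \<le> n" "u = q ^ (n - j)" "v = q powi (int m - int j)"
  shows "inverse t * q powi (- (int n - int (n - j) - 1)) * (t * q ^ m) = v * q"
    "t * q powi (- (int n - 2 * int (n - j) - 1)) * (t * q ^ m) = t\<^sup>2 * u * v * q"
    "q powi (- (int n - 2 * int (n - j) - 1)) * (t * q ^ m) = t * u * v * q"
    "q powi (- (int n - int (n - j) - 1)) * (t * q ^ m) = t * v * q"
proof -
  have *: "- (int n - int (n - j) - 1) = - (int j - 1)"
    "- (int n - 2 * int (n - j) - 1) = int n - 2 * int j + 1"
    "q powi (- (int j - 1)) = q powi (- int j) * q"
    using assms(1) q_powi_mult_cong[of "- int j" 1 "- (int j - 1)" 0] by (simp_all add: of_nat_diff)
  note shift = q_powi_shift[OF assms]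
  show "inverse t * q powi (- (int n - int (n - j) - 1)) * (t * q ^ m) = v * q"
    unfolding * using shift(1) unfolding * .
  show "t * q powi (- (int n - 2 * int (n - j) - 1)) * (t * q ^ m) = t\<^sup>2 * u * v * q"
    using arg_cong[OF shift(4), of "(*) t"] unfolding *(1,2) by (simp add: power2_eq_square mult_ac)
  show "q powi (- (int n - 2 * int (n - j) - 1)) * (t * q ^ m) = t * u * v * q"
    using shift(4) unfolding *(1,2) .
  show "q powi (- (int n - int (n - j) - 1)) * (t * q ^ m) = t * v * q"
    using arg_cong[OF shift(5), of "(*) q"] unfolding * by (simp add: mult_ac)
qed

text \<open>
  At index \<open>n - j\<close> the coefficient \<open>B\<close> has nearly the same factors as \<open>A\<close> and \<open>C\<close> at index \<open>j\<close>;
  this pairing is the one that occurs in the recurrences.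
\<close>
lemma rat_value_coeffB:
  assumes "j \<le> n" "u = q ^ (n - j)" "v = q powi (int m - int j)"
  shows "rat_value y (coeffB q t n (n - j))
     (u * qtbinom q t n j * ((1 - q ^ j) / (1 - q ^ n)) *
       ((qpoch (v * q) q j * qpoch (t\<^sup>2 * u * v * q) q (j - 1)) /
        (qpoch (t * u * v * q) q j * qpoch (t * v * q) q (j - 1))))"
proof -
  have "rat_value y (coeffB q t n (n - j))
     (q ^ (n - j) * qtbinom q t n (n - j) * ((1 - q ^ (n - (n - j))) / (1 - q ^ n)) *
       ((qpoch (v * q) q (n - (n - j)) * qpoch (t\<^sup>2 * u * v * q) q (n - (n - j) - 1)) /
        (qpoch (t * u * v * q) q (n - (n - j)) * qpoch (t * v * q) q (n - (n - j) - 1))))"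
    unfolding coeffB_def
    by (intro rat_value_mult rat_value_rconst rat_value_divide no_zero_divisors
        q_powi_shift_B[OF assms, THEN rat_value_Ypoch_point]
        q_powi_shift_B(3,4)[OF assms, THEN qpoch_point_nonzero])
  then show ?thesis
    using assms by (simp add: qtbinom_symmetric)
qed


abbreviation "evA n j \<equiv> rat_eval y (coeffA q t n j)"
abbreviation "evB n j \<equiv> rat_eval y (coeffB q t n j)"
abbreviation "evC n j \<equiv> rat_eval y (coeffC q t n j)"

lemma rat_defined_coeffs:
  assumes "j \<le> n"
  shows "rat_defined y (coeffC q t n j)" "rat_defined y (coeffA q t n j)"
    "rat_defined y (coeffB q t n j)"
  using rat_value_coeffC[OF assms refl refl] rat_value_coeffA[OF assms refl refl]
    rat_value_coeffB[OF diff_le_self[of n j] refl refl] assms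
  by (simp_all add: rat_value_def)

text \<open>
  The factor \<open>(q^(m-j+1); q)_j\<close> of \<open>C_j\<close> runs through \<open>1 - q^0\<close> when \<open>j > m\<close>.
\<close>
lemma evC_eq_0:
  assumes "j \<le> n" "j > m"
  shows "evC n j = 0"
proof -
  have "1 - q powi (int m - int j) * q * q ^ (j - 1 - m) = 0"
  proof -
    have "q * q ^ (j - 1 - m) = q powi (int j - int m)"
      using assms by (simp flip: of_nat_diff power_Suc)
        (metis Suc_diff_Suc diff_Suc_eq_diff_pred)
    then show ?thesis
      using q_powi_mult_cong[of "int m - int j" "int j - int m" 0 0] by (simp add: mult.assoc)
  qed
  moreover have "j - 1 - m < j"
    using assms by simp
  ultimately have "qpoch (q powi (int m - int j) * q) q j = 0"
    unfolding qpoch_def by (intro prod_zero bexI[of _ "j - 1 - m"]) simp_all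
  then show ?thesis
    using rat_valueD(1)[OF rat_value_coeffC[OF assms(1) refl refl]] by simp
qed

context
  fixes n j :: nat and u v J :: complex
  assumes j_le: "j \<le> n"
    and u: "u = q ^ (n - j)" and v: "v = q powi (int m - int j)" and J: "J = q ^ j"
begin

lemma q_power_n: "q ^ n = u * J"
  using j_le by (simp add: u J flip: power_add)

lemma uv_eq: "u * v = q powi (int m + int n - 2 * int j)"
proof -
  have "u = q powi int (n - j)"
    by (simp add: u)
  then show ?thesis
    using j_le q_powi_mult_cong[of "int (n - j)" "int m - int j" "int m + int n - 2 * int j" 0]
    by (simp add: v of_nat_diff)
qed

lemma tuv_neq_1: "1 - t * (u * v) \<noteq> 0" "1 - t\<^sup>2 * (u * v) \<noteq> 0"
  unfolding uv_eq by (rule t_q_powi_neq_1 t2_q_powi_neq_1)+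

lemma tv_neq_1: "1 - t * v \<noteq> 0"
  unfolding v by (rule t_q_powi_neq_1)

lemma qpoch_nonzero: "qpoch (t * u * v * q) q k \<noteq> 0" "qpoch (t * u * v) q k \<noteq> 0"
  "qpoch (t * v) q k \<noteq> 0" "qpoch (t * v * q) q k \<noteq> 0"
  using q_powi_shift(3-5)[OF j_le u v, THEN qpoch_point_nonzero]
    q_powi_shift_B(4)[OF j_le u v, THEN qpoch_point_nonzero] by blast+

lemma evC_value:
  "evC n j = qtbinom q t n j *
    ((qpoch (v * q) q j * qpoch (t\<^sup>2 * u * v) q j) /
        (qpoch (t * u * v * q) q j * qpoch (t * v) q j))"
  by (rule rat_valueD(1)[OF rat_value_coeffC[OF j_le u v]])

text \<open>
  The shifted factorials in \<open>A\<close> and \<open>B\<close> arise from those of \<open>C_j^(n)\<close> by multiplying or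
  dividing the argument by \<open>q\<close>, or by adding or removing factors at an end, and the binomial
  coefficients by raising indices by one. Each such change contributes only a few factors, so
  that no shifted factorial is left in the ratios.
\<close>
lemma evA_ratio:
  "evA n j = evC n j * ((1 - u) * (1 - t * (u * v) * J) / ((1 - u * J) * (1 - t * (u * v))))"
proof -
  have shift: "(1 - t * (u * v)) * qpoch (t * u * v * q) q j =
      (1 - t * (u * v) * J) * qpoch (t * u * v) q j"
    using qpoch_shift[of "t * u * v" q j] by (simp add: J mult.assoc)
  have nz: "1 - t * (u * v) * J \<noteq> 0"
  proof
    assume "1 - t * (u * v) * J = 0"
    with shift show False
      using tuv_neq_1(1) qpoch_nonzero(1)[of j] by simp
  qed
  have *: "X / (qpoch (t * v) q j * qpoch (t * u * v) q j) =
      X / (qpoch (t * u * v * q) q j * qpoch (t * v) q j) *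
        ((1 - t * (u * v) * J) / (1 - t * (u * v)))" for X
  proof -
    have "qpoch (t * u * v * q) q j =
        (1 - t * (u * v) * J) * qpoch (t * u * v) q j / (1 - t * (u * v))"
      using shift tuv_neq_1(1) by (simp add: field_simps)
    then show ?thesis
      using nz tuv_neq_1(1) by simp
  qed
  show ?thesis
    unfolding rat_valueD(1)[OF rat_value_coeffA[OF j_le u v]] evC_value q_power_n *
    by (simp add: mult_ac)
qed

lemma evB_ratio:
  "evB n (n - j) = evC n j * (u * (1 - J) * (1 - t * v) / ((1 - u * J) * (1 - t\<^sup>2 * (u * v))))"
proof (cases j)
  case 0
  then show ?thesis
    using rat_valueD(1)[OF rat_value_coeffB[OF j_le u v]] J by simp
next
  case (Suc i)
  have "qpoch (t\<^sup>2 * u * v) q j = (1 - t\<^sup>2 * (u * v)) * qpoch (t\<^sup>2 * u * v * q) q (j - 1)"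
    "qpoch (t * v) q j = (1 - t * v) * qpoch (t * v * q) q (j - 1)"
    by (simp_all add: Suc qpoch_Suc_left mult.assoc)
  then show ?thesis
    using tuv_neq_1(2) tv_neq_1
    unfolding rat_valueD(1)[OF rat_value_coeffB[OF j_le u v]] evC_value q_power_n J[symmetric]
    by (simp add: mult_ac)
qed

lemma evA_Suc_ratio:
  "evA (Suc n) j =
     evC n j * ((1 - t * u) * (1 - t\<^sup>2 * (u * v) * J) / ((1 - t * (u * J)) * (1 - t\<^sup>2 * (u * v))))"
proof -
  have j_le': "j \<le> Suc n" and u': "u * q = q ^ (Suc n - j)"
    using j_le by (simp_all add: u Suc_diff_le)
  have nz: "1 - q ^ Suc n \<noteq> 0" "1 - u * q \<noteq> 0" "1 - t * q ^ n \<noteq> 0"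
    using q_power_neq_1[of "Suc n"] q_power_neq_1[of "Suc n - j"] t_q_power_neq_1[of n] j_le
    by (simp_all add: u')
  have binom: "qtbinom q t (Suc n) j * ((1 - u * q) / (1 - q ^ Suc n)) =
      qtbinom q t n j * ((1 - t * u) / (1 - t * q ^ n))"
    using qtbinom_Suc[OF j_le] nz j_le u' by (simp add: Suc_diff_le u[symmetric] frac_eq_eq mult_ac)
  have "qpoch (t\<^sup>2 * u * v * q) q j =
      qpoch (t\<^sup>2 * u * v) q j * ((1 - t\<^sup>2 * (u * v) * J) / (1 - t\<^sup>2 * (u * v)))"
    using qpoch_shift[of "t\<^sup>2 * u * v" q j] tuv_neq_1(2) by (simp add: J frac_eq_eq field_simps)
  moreover have "t\<^sup>2 * (u * q) * v = t\<^sup>2 * u * v * q" "t * (u * q) * v = t * u * v * q"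
    by simp_all
  ultimately show ?thesis
    unfolding rat_valueD(1)[OF rat_value_coeffA[OF j_le' u' v]] evC_value binom q_power_n
    by (simp add: mult_ac)
qed

lemma evB_Suc_ratio:
  "evB (Suc n) (n - j) =
     evC n j * (u * (1 - t * J) * (1 - v) / ((1 - t * (u * J)) * (1 - t * (u * v))))"
proof -
  have j_le': "Suc j \<le> Suc n" and u': "u = q ^ (Suc n - Suc j)"
    using j_le by (simp_all add: u)
  define v' where v': "v' = q powi (int m - int (Suc j))"
  have v'_q: "v' * q = v" "c * v' * q = c * v" for c
    using q_powi_mult_cong[of "int m - int (Suc j)" 1 "int m - int j" 0] by (simp_all add: v' v)
  have nz: "1 - q ^ Suc n \<noteq> 0" "1 - q ^ Suc j \<noteq> 0" "1 - t * q ^ n \<noteq> 0"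
    by (intro q_power_neq_1 t_q_power_neq_1; simp)+
  have binom: "qtbinom q t (Suc n) (Suc j) * ((1 - q ^ Suc j) / (1 - q ^ Suc n)) =
      qtbinom q t n j * ((1 - t * J) / (1 - t * q ^ n))"
    using qtbinom_Suc_Suc[OF j_le] nz by (simp add: J frac_eq_eq mult_ac)
  have "qpoch v q (Suc j) = (1 - v) * qpoch (v * q) q j"
    "qpoch (t * u * v) q (Suc j) = (1 - t * (u * v)) * qpoch (t * u * v * q) q j"
    by (simp_all add: qpoch_Suc_left mult.assoc)
  then have "evB (Suc n) (Suc n - Suc j) =
     u * (qtbinom q t (Suc n) (Suc j) * ((1 - q ^ Suc j) / (1 - q ^ Suc n))) *
      ((1 - v) * qpoch (v * q) q j * qpoch (t\<^sup>2 * u * v) q j /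
        ((1 - t * (u * v)) * qpoch (t * u * v * q) q j * qpoch (t * v) q j))"
    unfolding rat_valueD(1)[OF rat_value_coeffB[OF j_le' u' v']] v'_q by simp
  then show ?thesis
    unfolding evC_value binom q_power_n by (simp add: mult_ac)
qed

end

section \<open>Term-by-term form of the recurrences\<close>

context
  fixes n j :: nat
  assumes n_pos: "n > 0" and j_le: "j \<le> n"
begin

text \<open>
  Every term is \<open>C_j^(n)\<close> times a rational function of \<open>u\<close>, \<open>v\<close>, \<open>J\<close> and \<open>t\<close>, by the ratio lemmas and
  \<open>q^n = u J\<close>, \<open>z = u v\<close>; after clearing denominators, each relation is a polynomial identity.
\<close>
lemma coefficient_recurrences:
  defines "z \<equiv> q powi (int m + int n - 2 * int j)"
  defines "A \<equiv> evA n j" and "B \<equiv> evB n (n - j)"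
    and "A' \<equiv> evA (Suc n) j" and "B' \<equiv> evB (Suc n) (n - j)"
  shows "A' = A + B * mixing z + q ^ n * mixing (q ^ n) * (t * B)"
    and "B' = B * damping z - A * (z * mixing z) + q ^ n * mixing (q ^ n) * A"
    and "t * B' = t * B * damping z - A * mixing z + mixing (q ^ n) * A"
    and "A' = A + t * B * (z * mixing z) + mixing (q ^ n) * B"
    and "evC n j = A' + symmetrizer (q ^ n) * B"
    and "evC n j * symmetrizer z = t * B' + symmetrizer (q ^ n) * A"
proof -
  define u v J where uvJ: "u = q ^ (n - j)" "v = q powi (int m - int j)" "J = q ^ j"
  have z: "z = u * v"
    using uv_eq[OF j_le uvJ(1,2)] by (simp add: z_def)
  have Q: "q ^ n = u * J"
    by (rule q_power_n[OF j_le uvJ])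
  have nz: "1 - u * J \<noteq> 0" "1 - t * (u * J) \<noteq> 0" "1 - t * (u * v) \<noteq> 0" "1 - t\<^sup>2 * (u * v) \<noteq> 0"
    using q_power_neq_1[OF n_pos] t_q_power_neq_1[of n] tuv_neq_1[OF j_le uvJ(1,2)]
    by (simp_all add: Q)
  note ratios = evA_ratio[OF j_le uvJ] evB_ratio[OF j_le uvJ] evA_Suc_ratio[OF j_le uvJ]
    evB_Suc_ratio[OF j_le uvJ]
  note defs = A_def B_def A'_def B'_def ratios step_defs Q z
  show "A' = A + B * mixing z + q ^ n * mixing (q ^ n) * (t * B)"
    unfolding defs using nz by (simp add: divide_simps) algebra
  show "B' = B * damping z - A * (z * mixing z) + q ^ n * mixing (q ^ n) * A"
    unfolding defs using nz by (simp add: divide_simps) algebra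
  show "t * B' = t * B * damping z - A * mixing z + mixing (q ^ n) * A"
    unfolding defs using nz by (simp add: divide_simps) algebra
  show "A' = A + t * B * (z * mixing z) + mixing (q ^ n) * B"
    unfolding defs using nz by (simp add: divide_simps) algebra
  show "evC n j = A' + symmetrizer (q ^ n) * B"
    unfolding defs using nz by (simp add: divide_simps) algebra
  show "evC n j * symmetrizer z = t * B' + symmetrizer (q ^ n) * A"
    unfolding defs using nz by (simp add: divide_simps) algebra
qed

text \<open>
  Either all coefficients vanish or \<open>j \<le> m\<close>, and then \<open>N = m + n - 2j\<close> is nonnegative. Moreover
  \<open>N = 0\<close> forces \<open>j = n\<close>, where \<open>A_j^(n)\<close> vanishes through its factor \<open>1 - q^(n-j)\<close>; this covers the
  recurrences that need a positive index.
\<close>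
lemma coefficient_cases:
  obtains (zero) "evC n j = 0" "evA n j = 0" "evB n (n - j) = 0" "evA (Suc n) j = 0"
      "evB (Suc n) (n - j) = 0"
  | (nonneg) k where "int m + int n - 2 * int j = int k" "evA n j = 0 \<or> k > 0"
proof (cases "m < j")
  case True
  then have "evC n j = 0"
    by (rule evC_eq_0[OF j_le])
  then show ?thesis
    using zero evA_ratio[OF j_le refl refl refl] evB_ratio[OF j_le refl refl refl]
      evA_Suc_ratio[OF j_le refl refl refl] evB_Suc_ratio[OF j_le refl refl refl]
    by simp
next
  case False
  have "evA n j = 0 \<or> m + n - 2 * j > 0"
    using evA_ratio[OF j_le refl refl refl] False j_le by (cases "j = n") auto
  then show ?thesis
    using nonneg[of "m + n - 2 * j"] False j_le by (simp add: of_nat_diff)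
qed

text \<open>
  The \<open>j\<close>-th term of \<open>E_(n+1) P_m = x (E_n P_m) + q^n \<mu> E_(1-n) P_m\<close>, where \<open>\<mu>\<close> is the mixing
  coefficient at \<open>q^n\<close>.
\<close>
lemma x_step:
  defines "N \<equiv> int m + int n - 2 * int j"
  shows "lmonom 1 1 * (lconst (evA n j) * macE q t N + lconst (evB n (n - j)) * macE q t (- N)) +
      lconst (q ^ n * mixing (q ^ n)) *
        (lconst (t * evB n (n - j)) * macE q t (N + 1) + lconst (evA n j) * macE q t (1 - N)) =
    lconst (evA (Suc n) j) * macE q t (N + 1) + lconst (evB (Suc n) (n - j)) * macE q t (1 - N)"
proof (cases rule: coefficient_cases)
  case zero
  then show ?thesis by simp
next
  case (nonneg k)
  have N: "N = int k"
    using nonneg by (simp add: N_def)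
  have z: "q powi (int m + int n - 2 * int j) = q ^ k"
    using nonneg by simp
  have "lconst (evA n j) * (lmonom 1 1 * macE q t N) = lconst (evA n j) *
      (macE q t (N + 1) - lconst (q ^ k * mixing (q ^ k)) * macE q t (1 - N))"
    using nonneg(2) x_macE_pos[of k] by (auto simp: N)
  moreover have "lmonom 1 1 * macE q t (- N) =
      lconst (damping (q ^ k)) * macE q t (1 - N) + lconst (mixing (q ^ k)) * macE q t (N + 1)"
    unfolding N by (rule x_macE_neg)
  ultimately show ?thesis
    unfolding coefficient_recurrences(1,2) z distrib_left
      mult.left_commute[of "lmonom 1 1" "lconst _"]
    by (simp add: algebra_simps mult_single single_add single_diff)
qed

text \<open>
  The \<open>j\<close>-th term of \<open>E_(-n) P_m = x^(-1) (E_(1-n) P_m) + \<mu> E_n P_m\<close>.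
\<close>
lemma inverse_x_step:
  defines "N \<equiv> int m + int n - 2 * int j"
  shows "lmonom 1 (- 1) *
        (lconst (t * evB n (n - j)) * macE q t (N + 1) + lconst (evA n j) * macE q t (1 - N)) +
      lconst (mixing (q ^ n)) *
        (lconst (evA n j) * macE q t N + lconst (evB n (n - j)) * macE q t (- N)) =
    lconst (t * evB (Suc n) (n - j)) * macE q t N + lconst (evA (Suc n) j) * macE q t (- N)"
proof (cases rule: coefficient_cases)
  case zero
  then show ?thesis by simp
next
  case (nonneg k)
  have N: "N = int k"
    using nonneg by (simp add: N_def)
  have z: "q powi (int m + int n - 2 * int j) = q ^ k"
    using nonneg by simp
  have "lconst (evA n j) * (lmonom 1 (- 1) * macE q t (1 - N)) = lconst (evA n j) *
      (macE q t (- N) - lconst (mixing (q ^ k)) * macE q t N)"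
    using nonneg(2) inverse_x_macE_neg[of k] by (auto simp: N)
  moreover have "lmonom 1 (- 1) * macE q t (N + 1) =
      lconst (damping (q ^ k)) * macE q t N + lconst (q ^ k * mixing (q ^ k)) * macE q t (- N)"
    unfolding N by (rule inverse_x_macE_pos)
  ultimately show ?thesis
    unfolding coefficient_recurrences(3,4) z distrib_left
      mult.left_commute[of "lmonom 1 (- 1)" "lconst _"]
    by (simp add: algebra_simps mult_single single_add single_diff)
qed

text \<open>
  The \<open>j\<close>-th term of \<open>P_n P_m\<close>: the sum of the terms of \<open>E_(-n) P_m\<close> and of the multiple of
  \<open>E_n P_m\<close> is again the symmetric combination of \<open>E_(-N)\<close> and \<open>E_N\<close>.
\<close>
lemma symmetrized_term:
  defines "N \<equiv> int m + int n - 2 * int j"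
  shows "(lconst (t * evB (Suc n) (n - j)) * macE q t N +
        lconst (evA (Suc n) j) * macE q t (- N)) +
      lconst (symmetrizer (q ^ n)) *
        (lconst (evA n j) * macE q t N + lconst (evB n (n - j)) * macE q t (- N)) =
    (if 2 * j \<le> m + n then lconst (evC n j) * macP q t (m + n - 2 * j) else 0)"
proof (cases rule: coefficient_cases)
  case zero
  then show ?thesis by simp
next
  case (nonneg k)
  have N: "N = int k"
    using nonneg by (simp add: N_def)
  have z: "q powi (int m + int n - 2 * int j) = q ^ k"
    using nonneg by simp
  have k: "2 * j \<le> m + n" "m + n - 2 * j = k"
    using nonneg(1) by linarith+
  have "lconst (evC n j) * macP q t k =
      lconst (evC n j * symmetrizer (q ^ k)) * macE q t N + lconst (evC n j) * macE q t (- N)"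
    unfolding N macP_eq_macE[of k] by (simp add: algebra_simps mult_single)
  also have "evC n j * symmetrizer (q ^ k) =
      t * evB (Suc n) (n - j) + symmetrizer (q ^ n) * evA n j"
    using coefficient_recurrences(6) unfolding z .
  finally show ?thesis
    unfolding k(2) coefficient_recurrences(5)
    using k(1) by (simp add: algebra_simps mult_single single_add)
qed

end

section \<open>The product formulas\<close>

lemma coefficients_outside:
  "evA (Suc n) (Suc n) = 0" "evB (Suc n) (Suc n) = 0"
  using evA_ratio[OF order.refl refl refl refl, of "Suc n"]
    evB_ratio[OF le0 refl refl refl, of "Suc n"] by simp_all

text \<open>
  The induction step acts on sums over \<open>j \<le> n + 1\<close>, whereas the induction hypothesis
  provides sums over \<open>j \<le> n\<close>, in the second case with \<open>j\<close> shifted by one. The term at the end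
  that is added is zero.
\<close>
lemma extend_sums:
  fixes f :: "int \<Rightarrow> laurent"
  defines "N \<equiv> \<lambda>n j. int m + int n - 2 * int j"
  shows "(\<Sum>j\<in>{0..n}. lconst (evA (Suc n) j) * f (N n j + 1)) =
      (\<Sum>j\<in>{0..Suc n}. lconst (evA (Suc n) j) * f (N (Suc n) j))"
    and "(\<Sum>j\<in>{0..n}. lconst (c * evB (Suc n) (n - j)) * f (N n j)) =
      (\<Sum>j\<in>{0..Suc n}. lconst (c * evB (Suc n) (Suc n - j)) * f (N (Suc n) j + 1))"
proof -
  have N: "N n j + 1 = N (Suc n) j" "N n j = N (Suc n) (Suc j) + 1" for j
    by (simp_all add: N_def)
  show "(\<Sum>j\<in>{0..n}. lconst (evA (Suc n) j) * f (N n j + 1)) =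
      (\<Sum>j\<in>{0..Suc n}. lconst (evA (Suc n) j) * f (N (Suc n) j))"
    by (simp add: N(1) coefficients_outside)
  show "(\<Sum>j\<in>{0..n}. lconst (c * evB (Suc n) (n - j)) * f (N n j)) =
      (\<Sum>j\<in>{0..Suc n}. lconst (c * evB (Suc n) (Suc n - j)) * f (N (Suc n) j + 1))"
    unfolding N(2) sum.atLeast0_atMost_Suc_shift by (simp add: coefficients_outside)
qed

lemma macE_pos_extended:
  assumes "macE q t (int (Suc n)) * macP q t m =
     (\<Sum>j\<in>{0..n}. lconst (evA (Suc n) j) * macE q t (int m + int n - 2 * int j + 1) +
                   lconst (evB (Suc n) (n - j)) * macE q t (1 - (int m + int n - 2 * int j)))"
  shows "macE q t (int (Suc n)) * macP q t m =
     (\<Sum>j\<in>{0..Suc n}. lconst (evA (Suc n) j) * macE q t (int m + int (Suc n) - 2 * int j) +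
        lconst (evB (Suc n) (Suc n - j)) * macE q t (- (int m + int (Suc n) - 2 * int j)))"
proof -
  have shift: "1 - (N + 1) = - N" for N :: int
    by simp
  show ?thesis
    using assms extend_sums(1)[of n "macE q t"] extend_sums(2)[of 1 n "\<lambda>N. macE q t (1 - N)"]
    by (simp only: sum.distrib mult_1 shift)
qed

lemma macE_neg_extended:
  assumes "macE q t (- int n) * macP q t m =
     (\<Sum>j\<in>{0..n}. lconst (t * evB (Suc n) (n - j)) * macE q t (int m + int n - 2 * int j) +
                   lconst (evA (Suc n) j) * macE q t (- (int m + int n - 2 * int j)))"
  shows "macE q t (- int n) * macP q t m =
     (\<Sum>j\<in>{0..Suc n}. lconst (t * evB (Suc n) (Suc n - j)) *
                        macE q t (int m + int (Suc n) - 2 * int j + 1) +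
        lconst (evA (Suc n) j) * macE q t (1 - (int m + int (Suc n) - 2 * int j)))"
proof -
  have shift: "1 - (N + 1) = - N" for N :: int
    by simp
  show ?thesis
    using assms extend_sums(2)[of t n "macE q t"] extend_sums(1)[of n "\<lambda>N. macE q t (1 - N)"]
    by (simp only: sum.distrib shift)
qed

text \<open>
  Both expansions are proved together, since each of them needs both products from the previous
  step.
\<close>
lemma macE_mult_macP:
  "macE q t (int (Suc n)) * macP q t m =
     (\<Sum>j\<in>{0..n}. lconst (evA (Suc n) j) * macE q t (int m + int n - 2 * int j + 1) +
                   lconst (evB (Suc n) (n - j)) * macE q t (1 - (int m + int n - 2 * int j))) \<and>
   macE q t (- int n) * macP q t m =
     (\<Sum>j\<in>{0..n}. lconst (t * evB (Suc n) (n - j)) * macE q t (int m + int n - 2 * int j) +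
                   lconst (evA (Suc n) j) * macE q t (- (int m + int n - 2 * int j)))"
  (is "?pos n \<and> ?neg n")
proof (induction n)
  case 0
  have C: "evC 0 0 = 1"
    using rat_valueD(1)[OF rat_value_coeffC[of 0 0, OF order.refl refl refl]] by simp
  have tq: "1 - t \<noteq> 0" "1 - t\<^sup>2 * q ^ m \<noteq> 0" "1 - t * q ^ m \<noteq> 0"
    using t_q_power_neq_1[of 0] t2_q_powi_neq_1[of "int m"] t_q_power_neq_1[of m] by simp_all
  have A: "evA (Suc 0) 0 = 1"
    using evA_Suc_ratio[of 0 0 _ _ _, OF order.refl refl refl refl] C tq by simp
  have B: "evB (Suc 0) 0 = (1 - q ^ m) / (1 - t * q ^ m)"
    using evB_Suc_ratio[of 0 0 _ _ _, OF order.refl refl refl refl] C tq by simp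
  have tB: "t * evB (Suc 0) 0 = symmetrizer (q ^ m)"
    by (simp add: B symmetrizer_def)
  \<comment> \<open>For \<open>n = 0\<close> the second expansion is just the decomposition of \<open>P_m\<close>.\<close>
  have neg: "?neg 0"
    using macP_eq_macE[of m] by (simp add: A tB)
  have pos: "lmonom 1 1 * macP q t m =
      macE q t (int m + 1) + lconst (evB (Suc 0) 0) * macE q t (1 - int m)"
  proof (cases "m = 0")
    case True
    then show ?thesis using B by (simp add: macE_1)
  next
    case False
    then have "m > 0" by simp
    have "mixing (q ^ m) + symmetrizer (q ^ m) = 1"
      "damping (q ^ m) - symmetrizer (q ^ m) * (q ^ m * mixing (q ^ m)) = evB (Suc 0) 0"
      using tq unfolding B step_defs by (simp_all add: divide_simps) algebra+
    then have "macE q t (int m + 1) + lconst (evB (Suc 0) 0) * macE q t (1 - int m) =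
        lconst (mixing (q ^ m) + symmetrizer (q ^ m)) * macE q t (int m + 1) +
        lconst (damping (q ^ m) - symmetrizer (q ^ m) * (q ^ m * mixing (q ^ m))) *
          macE q t (1 - int m)"
      by simp
    also have "\<dots> = lmonom 1 1 * macE q t (- int m) +
        lconst (symmetrizer (q ^ m)) * (lmonom 1 1 * macE q t (int m))"
      unfolding x_macE_neg x_macE_pos[OF \<open>m > 0\<close>]
      by (simp add: algebra_simps mult_single single_add single_diff)
    also have "\<dots> = lmonom 1 1 * macP q t m"
      by (simp add: macP_eq_macE[of m] algebra_simps)
    finally show ?thesis ..
  qed
  show ?case
    using neg pos by (simp add: A macE_1 add.commute)
next
  case (Suc n)
  note pos = macE_pos_extended[OF conjunct1[OF Suc.IH]]
  note neg = macE_neg_extended[OF conjunct2[OF Suc.IH]]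
  have "macE q t (int (Suc (Suc n))) * macP q t m =
      lmonom 1 1 * (macE q t (int (Suc n)) * macP q t m) +
      lconst (q ^ Suc n * mixing (q ^ Suc n)) * (macE q t (- int n) * macP q t m)"
  proof -
    have "macE q t (int (Suc (Suc n))) = lmonom 1 1 * macE q t (int (Suc n)) +
        lconst (q ^ Suc n * mixing (q ^ Suc n)) * macE q t (- int n)"
      using x_macE_pos[of "Suc n"] by (simp add: add.commute)
    then show ?thesis
      by (simp only: distrib_right mult.assoc)
  qed
  also have "\<dots> = (\<Sum>j\<in>{0..Suc n}.
      lconst (evA (Suc (Suc n)) j) * macE q t (int m + int (Suc n) - 2 * int j + 1) +
      lconst (evB (Suc (Suc n)) (Suc n - j)) * macE q t (1 - (int m + int (Suc n) - 2 * int j)))"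
    unfolding pos neg sum_distrib_left sum.distrib[symmetric]
    by (intro sum.cong refl) (use x_step[of "Suc n"] in simp)
  finally have "?pos (Suc n)" .
  have "macE q t (- int (Suc n)) * macP q t m =
      lmonom 1 (- 1) * (macE q t (- int n) * macP q t m) +
      lconst (mixing (q ^ Suc n)) * (macE q t (int (Suc n)) * macP q t m)"
  proof -
    have "macE q t (- int (Suc n)) = lmonom 1 (- 1) * macE q t (- int n) +
        lconst (mixing (q ^ Suc n)) * macE q t (int (Suc n))"
      using inverse_x_macE_neg[of "Suc n"] by simp
    then show ?thesis
      by (simp only: distrib_right mult.assoc)
  qed
  also have "\<dots> = (\<Sum>j\<in>{0..Suc n}.
      lconst (t * evB (Suc (Suc n)) (Suc n - j)) * macE q t (int m + int (Suc n) - 2 * int j) +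
      lconst (evA (Suc (Suc n)) j) * macE q t (- (int m + int (Suc n) - 2 * int j)))"
    unfolding pos neg sum_distrib_left sum.distrib[symmetric]
    by (intro sum.cong refl) (use inverse_x_step[of "Suc n"] in simp)
  finally have "?neg (Suc n)" .
  with \<open>?pos (Suc n)\<close> show ?case ..
qed

text \<open>
  The same expansions in the order of summation in which \<open>B\<close> occurs with index \<open>j\<close> instead of
  \<open>n - j\<close>.
\<close>
theorem macE_pos_mult_macP:
  "macE q t (int (Suc n)) * macP q t m =
     (\<Sum>j\<in>{0..n}. lconst (evA (Suc n) j) * macE q t (int m + int (Suc n) - 2 * int j)) +
     (\<Sum>j\<in>{0..n}. lconst (evB (Suc n) j) * macE q t (- int m + int (Suc n) - 2 * int j))"
proof -
  have "(\<Sum>j\<in>{0..n}. lconst (evB (Suc n) j) * macE q t (- int m + int (Suc n) - 2 * int j)) =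
      (\<Sum>j\<in>{0..n}. lconst (evB (Suc n) (n - j)) * macE q t (1 - (int m + int n - 2 * int j)))"
    by (subst sum.atLeastAtMost_rev, rule sum.cong)
      (auto simp: of_nat_diff intro!: arg_cong[where f = "macE q t"] arg_cong2[where f = "(*)"])
  moreover have "(\<Sum>j\<in>{0..n}. lconst (evA (Suc n) j) * macE q t (int m + int (Suc n) - 2 * int j)) =
      (\<Sum>j\<in>{0..n}. lconst (evA (Suc n) j) * macE q t (int m + int n - 2 * int j + 1))"
    by (intro sum.cong refl arg_cong[where f = "macE q t"] arg_cong2[where f = "(*)"]) simp
  ultimately show ?thesis
    by (simp only: conjunct1[OF macE_mult_macP[of n]] sum.distrib)
qed

theorem macE_neg_mult_macP:
  "macE q t (- int n) * macP q t m =
     (\<Sum>j\<in>{0..n}. lconst (t * evB (Suc n) j) * macE q t (int m - (int n - 2 * int j))) +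
     (\<Sum>j\<in>{0..n}. lconst (evA (Suc n) j) * macE q t (- int m - (int n - 2 * int j)))"
proof -
  have "(\<Sum>j\<in>{0..n}. lconst (t * evB (Suc n) j) * macE q t (int m - (int n - 2 * int j))) =
      (\<Sum>j\<in>{0..n}. lconst (t * evB (Suc n) (n - j)) * macE q t (int m + int n - 2 * int j))"
    by (subst sum.atLeastAtMost_rev, rule sum.cong)
      (auto simp: of_nat_diff intro!: arg_cong[where f = "macE q t"] arg_cong2[where f = "(*)"])
  moreover have "(\<Sum>j\<in>{0..n}. lconst (evA (Suc n) j) * macE q t (- int m - (int n - 2 * int j))) =
      (\<Sum>j\<in>{0..n}. lconst (evA (Suc n) j) * macE q t (- (int m + int n - 2 * int j)))"
    by (intro sum.cong refl arg_cong[where f = "macE q t"] arg_cong2[where f = "(*)"]) simp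
  ultimately show ?thesis
    by (simp only: conjunct2[OF macE_mult_macP[of n]] sum.distrib)
qed

theorem macP_mult_macP:
  assumes "n > 0"
  shows "macP q t n * macP q t m =
    (\<Sum>j\<in>{0..n}. if 2 * j \<le> m + n then lconst (evC n j) * macP q t (m + n - 2 * j) else 0)"
proof -
  have pos: "macE q t (int n) * macP q t m =
      (\<Sum>j\<in>{0..n}. lconst (evA n j) * macE q t (int m + int n - 2 * int j) +
                     lconst (evB n (n - j)) * macE q t (- (int m + int n - 2 * int j)))"
    using macE_pos_extended[OF conjunct1[OF macE_mult_macP[of "n - 1"]]] assms by simp
  have "macP q t n * macP q t m = macE q t (- int n) * macP q t m +
      lconst (symmetrizer (q ^ n)) * (macE q t (int n) * macP q t m)"
    by (simp add: macP_eq_macE[of n] algebra_simps)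
  also have "\<dots> = (\<Sum>j\<in>{0..n}.
      if 2 * j \<le> m + n then lconst (evC n j) * macP q t (m + n - 2 * j) else 0)"
    unfolding pos conjunct2[OF macE_mult_macP] sum_distrib_left sum.distrib[symmetric]
    by (intro sum.cong refl symmetrized_term assms) simp
  finally show ?thesis .
qed

end

theorem theorem6p2:
  fixes q_half t_half q t :: complex and l m :: nat and ev :: "ratfun \<Rightarrow> complex" and y :: complex
  assumes q_half: "q_half \<noteq> 0" and t_half: "t_half \<noteq> 0"
    and q: "q = q_half ^ 2" and t: "t = t_half ^ 2"
    and generic: "\<And>a b :: int. q powi a * t powi b = 1 \<Longrightarrow> a = 0 \<and> b = 0"
    and l: "l > 0" and m: "m > 0"
    and y: "y = inverse t_half * q_half powi (- int m)"
    and ev: "ev = rat_eval y"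
  shows
    \<comment> \<open>all coefficients can be evaluated\<close>
    "(\<forall>j\<in>{0..l}. rat_defined y (coeffC q t l j)) \<and>
     (\<forall>j\<in>{0..l - 1}. rat_defined y (coeffA q t l j) \<and> rat_defined y (coeffB q t l j)) \<and>
     (\<forall>j\<in>{0..l}. rat_defined y (coeffA q t (l + 1) j) \<and>
                 rat_defined y (rconst t * coeffB q t (l + 1) j)) \<and>
     \<comment> \<open>the terms omitted from the first product have coefficient zero\<close>
     (\<forall>j\<in>{0..l}. m + l < 2 * j \<longrightarrow> ev (coeffC q t l j) = 0) \<and>
     macP q t l * macP q t m =
       (\<Sum>j\<in>{0..l}. if 2 * j \<le> m + l
                    then lconst (ev (coeffC q t l j)) * macP q t (m + l - 2 * j) else 0) \<and>
     macE q t (int l) * macP q t m =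
       (\<Sum>j\<in>{0..l - 1}. lconst (ev (coeffA q t l j)) * macE q t (int m + int l - 2 * int j)) +
       (\<Sum>j\<in>{0..l - 1}. lconst (ev (coeffB q t l j)) * macE q t (- int m + int l - 2 * int j)) \<and>
     macE q t (- int l) * macP q t m =
       (\<Sum>j\<in>{0..l}. lconst (ev (rconst t * coeffB q t (l + 1) j)) *
                     macE q t (int m - (int l - 2 * int j))) +
       (\<Sum>j\<in>{0..l}. lconst (ev (coeffA q t (l + 1) j)) *
                     macE q t (- int m - (int l - 2 * int j)))"
proof -
  have q_nonzero: "q \<noteq> 0" and t_nonzero: "t \<noteq> 0"
    using q_half t_half q t by simp_all
  have y_powi: "y powi (- 2) = t * q ^ m"
  proof -
    have "y = inverse (t_half * q_half ^ m)"
      by (simp add: y power_int_minus)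
    then have "y powi (- 2) = (t_half * q_half ^ m)\<^sup>2"
      by (simp only: power_int_minus power_int_numeral power_inverse inverse_inverse_eq)
    also have "\<dots> = t * q ^ m"
      unfolding q t power_mult_distrib power_mult[symmetric] by (simp only: mult.commute)
    finally show ?thesis .
  qed
  interpret evaluation_point q t m y
    using q_nonzero t_nonzero generic y_powi by unfold_locales
  obtain n where n: "l = Suc n"
    using l by (cases l) auto
  have tB: "rat_value y (rconst t * coeffB q t (l + 1) j) (t * evB (Suc l) j)" if "j \<le> l" for j
    using rat_defined_coeffs(3)[of j "Suc l"] that
    by (intro rat_value_mult rat_value_rconst) (simp add: rat_value_def)
  show ?thesis
    unfolding ev
  proof (intro conjI ballI impI)
    show "macP q t l * macP q t m =
       (\<Sum>j\<in>{0..l}. if 2 * j \<le> m + l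
                    then lconst (evC l j) * macP q t (m + l - 2 * j) else 0)"
      by (rule macP_mult_macP[OF l])
    show "macE q t (int l) * macP q t m =
       (\<Sum>j\<in>{0..l - 1}. lconst (evA l j) * macE q t (int m + int l - 2 * int j)) +
       (\<Sum>j\<in>{0..l - 1}. lconst (evB l j) * macE q t (- int m + int l - 2 * int j))"
      using macE_pos_mult_macP[of n] by (simp only: n diff_Suc_1)
    have "(\<Sum>j\<in>{0..l}. lconst (rat_eval y (rconst t * coeffB q t (l + 1) j)) *
                     macE q t (int m - (int l - 2 * int j))) =
        (\<Sum>j\<in>{0..l}. lconst (t * evB (Suc l) j) * macE q t (int m - (int l - 2 * int j)))"
      using rat_valueD(1)[OF tB] by (intro sum.cong) simp_all
    then show "macE q t (- int l) * macP q t m =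
       (\<Sum>j\<in>{0..l}. lconst (rat_eval y (rconst t * coeffB q t (l + 1) j)) *
                     macE q t (int m - (int l - 2 * int j))) +
       (\<Sum>j\<in>{0..l}. lconst (evA (l + 1) j) * macE q t (- int m - (int l - 2 * int j)))"
      using macE_neg_mult_macP[of l] by simp
  next
    fix j assume j: "j \<in> {0..l}"
    then show "rat_defined y (coeffC q t l j)" "rat_defined y (coeffA q t (l + 1) j)"
      by (auto intro!: rat_defined_coeffs)
    from j show "rat_defined y (rconst t * coeffB q t (l + 1) j)"
      by (intro rat_valueD(2)[OF tB]) simp
    assume "m + l < 2 * j"
    with j show "evC l j = 0"
      by (intro evC_eq_0) auto
  next
    fix j assume "j \<in> {0..l - 1}"
    then have "j \<le> l" by auto
    then show "rat_defined y (coeffA q t l j)" "rat_defined y (coeffB q t l j)"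
      by (rule rat_defined_coeffs)+
  qed
qed

end
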